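(* Let $\mathbb{E}_1,\mathbb{E}_2$ be Euclidean spaces, let $w\in\mathbb{E}_2\setminus\{0\}$ and let $H=\{x\in\mathbb{E}_2 : \langle w,x\rangle\ge 0\}$ be the associated half-space. Then for $F:D\to\mathbb{E}_2$ with $D\subset\mathbb{E}_1$ nonempty and convex we have: (a) $F$ is $H$-convex if and only if $\langle w,F\rangle$ is convex. (b) $F$ is $H$-closed if $\langle w,F\rangle$ is lower semicontinuous.
   Context: A Euclidean space is a finite-dimensional real inner product space. For a cone $K\subset\mathbb{E}_2$ (a nonempty set closed under multiplication by all $\lambda\ge0$) and $F:D\to\mathbb{E}_2$, the $K$-epigraph is $K\text{-}\mathrm{epi}\,F:=\{(x,y)\in D\times\mathbb{E}_2 : y-F(x)\in K\}$; $F$ is $K$-convex if $K\text{-}\mathrm{epi}\,F$ is convex, and $K$-closed if $K\text{-}\mathrm{epi}\,F$ is closed in $\mathbb{E}_1\times\mathbb{E}_2$. For $u\in\mathbb{E}_2$ the scalarization $\langle u,F\rangle:\mathbb{E}_1\to\mathbb{R}\cup\{+\infty\}$ is $\langle u,F\rangle(x)=\langle u,F(x)\rangle$ for $x\in D$ and $+\infty$ for $x\notin D$; convexity and lower semicontinuity are those of this extended-real-valued function on all of $\mathbb{E}_1$. *)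

theory Defs
  imports "HOL-Analysis.Analysis"
begin

text \<open>
  A Euclidean space is a type of class \<^class>\<open>real_inner\<close> satisfying the predicate below.  The class
  \<^class>\<open>euclidean_space\<close> is not used because it excludes the zero-dimensional space.
\<close>

definition finite_dimensional :: "'a::real_vector itself \<Rightarrow> bool" where
  "finite_dimensional _ \<longleftrightarrow> (\<exists>B::'a set. finite B \<and> span B = UNIV)"

lemma finite_dimensional_euclidean_space: "finite_dimensional TYPE('a::euclidean_space)"
  unfolding finite_dimensional_def using finite_Basis span_Basis by blast

text \<open>
  A map \<open>F : D \<rightarrow> E\<close> is represented by a total function together with \<open>D\<close>; none of the notions
  below depends on the values of \<open>F\<close> outside \<open>D\<close>.
\<close>

definition K_epi :: "'b set \<Rightarrow> 'a set \<Rightarrow> ('a \<Rightarrow> 'b::ab_group_add) \<Rightarrow> ('a \<times> 'b) set" where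
  "K_epi K D F = {(x, y). x \<in> D \<and> y - F x \<in> K}"

definition K_convex :: "'b set \<Rightarrow> 'a set \<Rightarrow> ('a::real_vector \<Rightarrow> 'b::real_vector) \<Rightarrow> bool" where
  "K_convex K D F \<longleftrightarrow> convex (K_epi K D F)"

definition K_closed ::
    "'b set \<Rightarrow> 'a set \<Rightarrow> ('a::topological_space \<Rightarrow> 'b::{topological_space, ab_group_add}) \<Rightarrow> bool" where
  "K_closed K D F \<longleftrightarrow> closed (K_epi K D F)"

definition scalarization :: "'b::real_inner \<Rightarrow> 'a set \<Rightarrow> ('a \<Rightarrow> 'b) \<Rightarrow> 'a \<Rightarrow> ereal" where
  "scalarization u D F x = (if x \<in> D then ereal (u \<bullet> F x) else \<infinity>)"

text \<open>
  The inequality is meant for functions with values in \<open>\<real> \<union> {+\<infinity>}\<close>; for these the right-hand side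
  never contains the expression \<open>\<infinity> - \<infinity>\<close>, and, as the weights are positive, never \<open>0 \<cdot> \<infinity>\<close>.
\<close>

definition ereal_convex :: "('a::real_vector \<Rightarrow> ereal) \<Rightarrow> bool" where
  "ereal_convex f \<longleftrightarrow>
     (\<forall>x y t. 0 < t \<and> t < 1 \<longrightarrow>
        f ((1 - t) *\<^sub>R x + t *\<^sub>R y) \<le> ereal (1 - t) * f x + ereal t * f y)"

definition lower_semicontinuous :: "('a::topological_space \<Rightarrow> ereal) \<Rightarrow> bool" where
  "lower_semicontinuous f \<longleftrightarrow> (\<forall>x. f x \<le> Liminf (nhds x) f)"

end

theory Submission
  imports Defs
begin

text \<open>
  A point \<open>y\<close> lies in \<open>F x + H\<close> exactly when \<open>\<langle>w, F x\<rangle> \<le> \<langle>w, y\<rangle>\<close>.  Hence the \<open>H\<close>-epigraph of \<open>F\<close> is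
  the preimage of the ordinary epigraph of \<open>\<langle>w, F\<rangle>\<close> under the continuous linear map
  \<open>(x, y) \<mapsto> (x, \<langle>w, y\<rangle>)\<close> (lemma \<open>K_epi_halfspace_eq_vimage\<close>), and both parts reduce to the classical
  facts about the epigraph of a scalar function.

  As \<open>w \<noteq> 0\<close>, this linear map is onto, so the scalar epigraph is also the image of the
  \<open>H\<close>-epigraph.  Convexity passes to linear images and to linear preimages, so one of the two sets is
  convex if and only if the other one is; and the scalar epigraph is convex exactly when \<open>\<langle>w, F\<rangle>\<close> is
  a convex function.  For closedness only the preimage is used: a lower semicontinuous function has
  a closed epigraph, and preimages of closed sets under continuous maps are closed.
\<close>

lemma scalarization_le_ereal_iff:
  "scalarization u D F x \<le> ereal r \<longleftrightarrow> (x, r) \<in> epigraph D (\<lambda>x. u \<bullet> F x)"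
  by (simp add: scalarization_def mem_epigraph)

lemma K_epi_halfspace_eq_vimage:
  "K_epi {z. 0 \<le> w \<bullet> z} D F = (\<lambda>(x, y). (x, w \<bullet> y)) -` epigraph D (\<lambda>x. w \<bullet> F x)"
  by (auto simp: K_epi_def mem_epigraph inner_diff_right)

text \<open>The vector \<open>(r / \<langle>w, w\<rangle>) w\<close> has inner product \<open>r\<close> with \<open>w\<close>.\<close>

lemma surj_Pair_inner:
  fixes w :: "'b::real_inner"
  assumes "w \<noteq> 0"
  shows "surj (\<lambda>(x, y). (x, w \<bullet> y))"
proof (rule surjI)
  fix p :: "'c \<times> real"
  show "(\<lambda>(x, y). (x, w \<bullet> y)) (fst p, (snd p / (w \<bullet> w)) *\<^sub>R w) = p"
    using assms by (simp add: prod_eq_iff)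
qed

lemma linear_Pair_inner:
  fixes w :: "'b::real_inner"
  shows "linear (\<lambda>(x::'a::real_vector, y). (x, w \<bullet> y))"
  by (rule linearI) (auto simp: inner_add_right)

lemma K_convex_halfspace_iff:
  fixes F :: "'a::real_vector \<Rightarrow> 'b::real_inner"
  assumes "w \<noteq> 0"
  shows "K_convex {z. 0 \<le> w \<bullet> z} D F \<longleftrightarrow> convex_on D (\<lambda>x. w \<bullet> F x)"
proof -
  let ?L = "\<lambda>(x::'a, y::'b). (x, w \<bullet> y)"
  let ?E = "epigraph D (\<lambda>x. w \<bullet> F x)"
  have "convex (?L -` ?E) \<longleftrightarrow> convex ?E"
  proof
    assume "convex (?L -` ?E)"
    then have "convex (?L ` (?L -` ?E))"
      by (rule convex_linear_image[OF linear_Pair_inner])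
    then show "convex ?E"
      by (simp only: surj_image_vimage_eq[OF surj_Pair_inner[OF assms]])
  next
    assume "convex ?E"
    then show "convex (?L -` ?E)"
      by (rule convex_linear_vimage[OF linear_Pair_inner])
  qed
  then show ?thesis
    by (auto simp: K_convex_def K_epi_halfspace_eq_vimage convex_epigraph convex_on_def)
qed

text \<open>
  The value \<open>\<infinity>\<close> off \<open>D\<close> makes the inequality trivial when an endpoint lies off \<open>D\<close>; when both
  endpoints lie in \<open>D\<close>, its right-hand side is finite, which forces the intermediate points into \<open>D\<close>.
  So the extended-valued inequality encodes the convexity of \<open>D\<close> together with that of the scalar
  function on \<open>D\<close>.
\<close>

lemma ereal_convex_scalarization_iff:
  "ereal_convex (scalarization u D F) \<longleftrightarrow> convex_on D (\<lambda>x. u \<bullet> F x)"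
proof
  assume conv: "ereal_convex (scalarization u D F)"
  have *: "(1 - t) *\<^sub>R x + t *\<^sub>R y \<in> D \<and>
      u \<bullet> F ((1 - t) *\<^sub>R x + t *\<^sub>R y) \<le> (1 - t) * (u \<bullet> F x) + t * (u \<bullet> F y)"
    if "0 < t" "t < 1" "x \<in> D" "y \<in> D" for x y t
  proof -
    have "scalarization u D F ((1 - t) *\<^sub>R x + t *\<^sub>R y)
        \<le> ereal ((1 - t) * (u \<bullet> F x) + t * (u \<bullet> F y))"
      using conv[unfolded ereal_convex_def, rule_format, of t x y] that
      by (simp add: scalarization_def[of u D F x] scalarization_def[of u D F y])
    then show ?thesis
      by (simp add: scalarization_le_ereal_iff mem_epigraph)
  qed
  have "convex D"
    unfolding convex_alt
  proof (intro ballI allI impI)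
    fix x y and t :: real
    assume "x \<in> D" "y \<in> D" "0 \<le> t \<and> t \<le> 1"
    then show "(1 - t) *\<^sub>R x + t *\<^sub>R y \<in> D"
      using *[of t x y] by (cases "t = 0 \<or> t = 1") auto
  qed
  then show "convex_on D (\<lambda>x. u \<bullet> F x)"
    using * by (intro convex_onI) auto
next
  assume conv: "convex_on D (\<lambda>x. u \<bullet> F x)"
  show "ereal_convex (scalarization u D F)"
    unfolding ereal_convex_def
  proof (intro allI impI)
    fix x y and t :: real
    assume t: "0 < t \<and> t < 1"
    show "scalarization u D F ((1 - t) *\<^sub>R x + t *\<^sub>R y)
        \<le> ereal (1 - t) * scalarization u D F x + ereal t * scalarization u D F y"
    proof (cases "x \<in> D \<and> y \<in> D")
      case True
      then have "(1 - t) *\<^sub>R x + t *\<^sub>R y \<in> D"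
        using t convex_on_imp_convex[OF conv] by (simp add: convex_alt)
      then show ?thesis
        using True t convex_onD[OF conv, of t x y] by (simp add: scalarization_def)
    next
      case False
      then show ?thesis
        using t by (auto simp: scalarization_def)
    qed
  qed
qed

text \<open>
  If \<open>(x\<^sub>0, r\<^sub>0)\<close> is not in the epigraph, a number \<open>c\<close> strictly between \<open>r\<^sub>0\<close> and \<open>f x\<^sub>0\<close> separates:
  lower semicontinuity keeps \<open>f\<close> above \<open>c\<close> near \<open>x\<^sub>0\<close>, so the complement contains a product
  neighbourhood.
\<close>

lemma closed_epigraph_if_lower_semicontinuous:
  fixes f :: "'a::topological_space \<Rightarrow> ereal"
  assumes "lower_semicontinuous f"
  shows "closed {(x, r). f x \<le> ereal r}"
  unfolding closed_def
proof (rule topological_space_class.openI)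
  fix p
  assume "p \<in> - {(x, r). f x \<le> ereal r}"
  then obtain x0 r0 where p: "p = (x0, r0)" and less: "ereal r0 < f x0"
    by (cases p) auto
  obtain c where c: "r0 < c" "ereal c < f x0"
    using ereal_dense2[OF less] by auto
  have "ereal c < Liminf (nhds x0) f"
    using assms c(2) unfolding lower_semicontinuous_def by (metis less_le_trans)
  then have "\<forall>\<^sub>F x in nhds x0. ereal c < f x"
    by (rule less_LiminfD)
  then obtain U where U: "open U" "x0 \<in> U" "\<And>x. x \<in> U \<Longrightarrow> ereal c < f x"
    unfolding eventually_nhds by blast
  have "\<not> f x \<le> ereal r" if "x \<in> U" "r < c" for x r
    using U(3)[OF that(1)] that(2) by (meson less_ereal.simps(1) less_trans not_le)
  then have "U \<times> {..<c} \<subseteq> - {(x, r). f x \<le> ereal r}"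
    by auto
  moreover have "open (U \<times> {..<c})" "p \<in> U \<times> {..<c}"
    using U c p by (auto intro: open_Times)
  ultimately show "\<exists>T. open T \<and> p \<in> T \<and> T \<subseteq> - {(x, r). f x \<le> ereal r}"
    by blast
qed

lemma K_closed_halfspace_if_lower_semicontinuous:
  fixes F :: "'a::topological_space \<Rightarrow> 'b::real_inner"
  assumes "lower_semicontinuous (scalarization w D F)"
  shows "K_closed {z. 0 \<le> w \<bullet> z} D F"
proof -
  have "closed (epigraph D (\<lambda>x. w \<bullet> F x))"
    using closed_epigraph_if_lower_semicontinuous[OF assms]
    by (simp add: scalarization_le_ereal_iff)
  moreover have "continuous_on UNIV (\<lambda>(x::'a, y). (x, w \<bullet> y))"
    by (simp add: case_prod_beta) (intro continuous_intros)
  ultimately show ?thesis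
    unfolding K_closed_def K_epi_halfspace_eq_vimage by (intro closed_vimage)
qed

theorem proposition22:
  fixes w :: "'b::real_inner"
    and H :: "'b set"
    and D :: "'a::real_inner set"
    and F :: "'a \<Rightarrow> 'b"
  assumes "finite_dimensional TYPE('a)"
    and "finite_dimensional TYPE('b)"
    and "w \<noteq> 0"
    and "H = {x. w \<bullet> x \<ge> 0}"
    and "D \<noteq> {}"
    and "convex D"
  shows "(K_convex H D F \<longleftrightarrow> ereal_convex (scalarization w D F)) \<and>
         (lower_semicontinuous (scalarization w D F) \<longrightarrow> K_closed H D F)"
  using K_convex_halfspace_iff[OF \<open>w \<noteq> 0\<close>] ereal_convex_scalarization_iff
    K_closed_halfspace_if_lower_semicontinuous
  unfolding \<open>H = {x. w \<bullet> x \<ge> 0}\<close> by blast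

end
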